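(* Let $\mathbf{K}$ be an $\mathbf{o}$-symmetric convex body in $\mathbb{R}^d$. (a) If the balls of $\mathbb{M}^d_{\mathbf{K}}$ are generating sets in $\mathbb{R}^d$, then the balls of $\mathbb{M}^d_{\mathbf{K}}$ are volumetric maximizers for $r$-ball bodies in $\mathbb{M}^d_{\mathbf{K}}$. (b) If the balls of $\mathbb{M}^d_{\mathbf{K}}$ are volumetric maximizers for $r$-ball bodies in $\mathbb{M}^d_{\mathbf{K}}$, then $$V_d(P^r_{\mathbf{K}})\leq V_d(Q^r_{\mathbf{K}})$$ holds whenever $Q=\{\mathbf{q}_1,\dots,\mathbf{q}_N\}\subset\mathbb{R}^d$ is a uniform contraction of $P=\{\mathbf{p}_1,\dots,\mathbf{p}_N\}\subset\mathbb{R}^d$ with separating value $\lambda$ in $\mathbb{M}^d_{\mathbf{K}}$ and $r>0$, $\lambda>0$, $d>1$, $N\geq 3^d$.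
   Context: An $\mathbf{o}$-symmetric convex body $\mathbf{K}\subset\mathbb{R}^d$ is a compact convex set with nonempty interior that is symmetric about the origin $\mathbf{o}$. It generates the norm $\|\mathbf{x}\|_{\mathbf{K}}:=\min\{\mu\geq 0 \mid \mathbf{x}\in\mu\mathbf{K}\}$, and $\mathbb{M}^d_{\mathbf{K}}$ denotes $\mathbb{R}^d$ equipped with this norm. The balls of $\mathbb{M}^d_{\mathbf{K}}$ are the sets $B_{\mathbf{K}}[\mathbf{x},r]:=\mathbf{x}+r\mathbf{K}$ with $\mathbf{x}\in\mathbb{R}^d$, $r>0$. For $X\subseteq\mathbb{R}^d$ and $r>0$, $X^r_{\mathbf{K}}:=\bigcap\{B_{\mathbf{K}}[\mathbf{x},r]\mid \mathbf{x}\in X\}$. $V_d(\cdot)$ is Lebesgue measure in $\mathbb{R}^d$, with $V_d(\emptyset)=0$. A nonempty compact convex set $A'\subset\mathbb{R}^d$ is a summand of a nonempty compact convex set $A\subset\mathbb{R}^d$ if there is a nonempty compact convex set $A''\subset\mathbb{R}^d$ with $A'+A''=A$ (Minkowski sum). A convex body $\mathbf{B}\subset\mathbb{R}^d$ is a generating set if any nonempty intersection of (a nonempty family of) translates of $\mathbf{B}$ is a summand of $\mathbf{B}$. The balls of $\mathbb{M}^d_{\mathbf{K}}$ are volumetric maximizers for $r$-ball bodies in $\mathbb{M}^d_{\mathbf{K}}$ if for every nonempty compact set $A\subset\mathbb{R}^d$ with $V_d(A)>0$ the inequality $$V_d(A^r_{\mathbf{K}})\leq V_d(B_{\mathbf{K}}[\mathbf{o},r-r_{\mathbf{K}}(A)])$$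 holds for all $r>r_{\mathbf{K}}(A)$, where $r_{\mathbf{K}}(A)>0$ is defined by $V_d(A)=V_d(B_{\mathbf{K}}[\mathbf{o},r_{\mathbf{K}}(A)])$. The labeled point set $Q=\{\mathbf{q}_1,\dots,\mathbf{q}_N\}$ is a uniform contraction of the labeled point set $P=\{\mathbf{p}_1,\dots,\mathbf{p}_N\}$ with separating value $\lambda>0$ in $\mathbb{M}^d_{\mathbf{K}}$ if $\|\mathbf{q}_i-\mathbf{q}_j\|_{\mathbf{K}}\leq\lambda\leq\|\mathbf{p}_i-\mathbf{p}_j\|_{\mathbf{K}}$ for all $1\leq i<j\leq N$. *)

theory Defs
  imports "HOL-Analysis.Analysis" "HOL-Library.Set_Algebras"
begin

definition convex_body :: "(real ^ 'n) set \<Rightarrow> bool" where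
  "convex_body K \<longleftrightarrow> compact K \<and> convex K \<and> interior K \<noteq> {}"

definition o_symmetric :: "(real ^ 'n) set \<Rightarrow> bool" where
  "o_symmetric K \<longleftrightarrow> uminus ` K = K"

(* Well defined (the minimum exists and is unique) if K is an o-symmetric convex body. *)
definition K_norm :: "(real ^ 'n) set \<Rightarrow> real ^ 'n \<Rightarrow> real" where
  "K_norm K x = (LEAST \<mu>. 0 \<le> \<mu> \<and> x \<in> (*\<^sub>R) \<mu> ` K)"

definition K_ball :: "(real ^ 'n) set \<Rightarrow> real ^ 'n \<Rightarrow> real \<Rightarrow> (real ^ 'n) set" where
  "K_ball K x r = (+) x ` ((*\<^sub>R) r ` K)"

(* K_ball_body K r X is the set written X with superscript r and subscript K. *)
definition K_ball_body :: "(real ^ 'n) set \<Rightarrow> real \<Rightarrow> (real ^ 'n) set \<Rightarrow> (real ^ 'n) set" where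
  "K_ball_body K r X = (\<Inter>x\<in>X. K_ball K x r)"

(* All sets measured in the statement are compact, so the convention that
   measure returns 0 on sets of infinite measure plays no role. *)
abbreviation vol :: "(real ^ 'n) set \<Rightarrow> real" where
  "vol \<equiv> measure lebesgue"

(* A' + A'' is the Minkowski sum from Set_Algebras. *)
definition summand :: "(real ^ 'n) set \<Rightarrow> (real ^ 'n) set \<Rightarrow> bool" where
  "summand A' A \<longleftrightarrow>
     A' \<noteq> {} \<and> compact A' \<and> convex A' \<and>
     A \<noteq> {} \<and> compact A \<and> convex A \<and>
     (\<exists>A''. A'' \<noteq> {} \<and> compact A'' \<and> convex A'' \<and> A' + A'' = A)"

(* T is the set of translation vectors of a (possibly infinite) family of translates. *)
definition generating_set :: "(real ^ 'n) set \<Rightarrow> bool" where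
  "generating_set B \<longleftrightarrow>
     convex_body B \<and>
     (\<forall>T. T \<noteq> {} \<and> (\<Inter>t\<in>T. (+) t ` B) \<noteq> {} \<longrightarrow> summand (\<Inter>t\<in>T. (+) t ` B) B)"

(* Existence and uniqueness hold if K is an o-symmetric convex body and vol A > 0. *)
definition vol_radius :: "(real ^ 'n) set \<Rightarrow> (real ^ 'n) set \<Rightarrow> real" where
  "vol_radius K A = (THE \<rho>. 0 < \<rho> \<and> vol A = vol (K_ball K 0 \<rho>))"

definition balls_volumetric_maximizers :: "(real ^ 'n) set \<Rightarrow> bool" where
  "balls_volumetric_maximizers K \<longleftrightarrow>
     (\<forall>A. A \<noteq> {} \<and> compact A \<and> 0 < vol A \<longrightarrow>
        (\<forall>r > vol_radius K A.
           vol (K_ball_body K r A) \<le> vol (K_ball K 0 (r - vol_radius K A))))"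

(* Labeled point sets are given by their labelings on {1..N}; the points need not be distinct.
   q is the contraction of p. *)
definition uniform_contraction ::
  "(real ^ 'n) set \<Rightarrow> nat \<Rightarrow> real \<Rightarrow> (nat \<Rightarrow> real ^ 'n) \<Rightarrow> (nat \<Rightarrow> real ^ 'n) \<Rightarrow> bool" where
  "uniform_contraction K N l q p \<longleftrightarrow>
     0 < l \<and>
     (\<forall>i j. 1 \<le> i \<and> i < j \<and> j \<le> N \<longrightarrow>
        K_norm K (q i - q j) \<le> l \<and> l \<le> K_norm K (p i - p j))"

end

theory Submission
  imports Defs
begin

text \<open>
  Throughout, \<open>r K\<close> denotes the scaled body, \<open>n\<close> the dimension, and \<open>v\<close> the volume.

  Part (a) is duality plus the Brunn--Minkowski inequality. Let \<open>X\<close> be a nonempty \<open>r\<close>-ball body of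
  \<open>A\<close>. Being an intersection of translates of \<open>r K\<close>, it is a summand: \<open>X + C = r K\<close>. Every \<open>a \<in> A\<close>
  satisfies \<open>X - a \<subseteq> r K = X + C\<close>, and the summand \<open>X\<close> can be cancelled, so \<open>- A \<subseteq> C\<close>
  (\<open>set_plus_cancel_translate\<close>). Brunn--Minkowski (\<open>brunn_minkowski_convex\<close>) now gives
  \<open>v(X)^(1/n) + v(A)^(1/n) \<le> v(X)^(1/n) + v(C)^(1/n) \<le> r v(K)^(1/n)\<close>, and
  \<open>v(A)^(1/n)\<close> equals the volumetric radius of \<open>A\<close> times \<open>v(K)^(1/n)\<close>.

  Part (b) compares both sides with a ball of radius \<open>r - l\<close>, which is empty if \<open>r < l\<close>. The balls of radius \<open>l/2\<close> about the
  points \<open>p i\<close> do not overlap, so their union \<open>A\<close> has volumetric radius \<open>N^(1/n) l/2 \<ge> 3 l/2\<close>, which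
  is where \<open>N \<ge> 3^n\<close> enters. The \<open>r\<close>-ball body of the points \<open>p i\<close> lies in the \<open>(r + l/2)\<close>-ball body
  of \<open>A\<close>, whose volume is at most that of a ball of radius \<open>r + l/2 - 3 l/2 = r - l\<close>. On the
  other hand all \<open>q i\<close> are within distance \<open>l\<close> of \<open>q 1\<close>, so the ball of radius \<open>r - l\<close> about \<open>q 1\<close>
  lies in the \<open>r\<close>-ball body of the points \<open>q i\<close>.

  The Brunn--Minkowski inequality is proved by the method of Hadwiger and Ohmann. For two boxes it is the
  inequality of arithmetic and geometric means (\<open>root_prod_superadditive\<close>). For two finite unions of
  disjoint boxes (\<open>brunn_minkowski_box_families\<close>) it follows by induction on the number of boxes: a
  coordinate hyperplane separating two boxes of one union is matched with a parallel
  hyperplane that cuts the other union in the same proportion. Open sets, and from them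
  convex sets, are approximated from inside by such unions.
\<close>

section \<open>The Brunn--Minkowski inequality for finite unions of boxes\<close>

text \<open>Applying the inequality of arithmetic and geometric means to the ratios \<open>u i / (u i + v i)\<close> and to the
  ratios \<open>v i / (u i + v i)\<close>, the two arithmetic means add up to \<open>1\<close>. This is
  Brunn--Minkowski for two boxes with side lengths \<open>u i\<close> and \<open>v i\<close>.\<close>
lemma root_prod_superadditive:
  fixes u v :: "'a \<Rightarrow> real"
  assumes S: "finite S" "S \<noteq> {}"
    and u: "\<And>i. i \<in> S \<Longrightarrow> 0 < u i" and v: "\<And>i. i \<in> S \<Longrightarrow> 0 < v i"
  shows "root (card S) (\<Prod>i\<in>S. u i) + root (card S) (\<Prod>i\<in>S. v i)
    \<le> root (card S) (\<Prod>i\<in>S. u i + v i)"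
proof -
  define n where "n = card S"
  have n: "n > 0" using S by (simp add: n_def card_gt_0_iff)
  have amgm: "root n (\<Prod>i\<in>S. w i / (u i + v i)) \<le> (\<Sum>i\<in>S. w i / (u i + v i)) / n"
    if "\<And>i. i \<in> S \<Longrightarrow> 0 < w i" for w
  proof -
    have pos: "0 < w i / (u i + v i)" if "i \<in> S" for i
      using that u v \<open>\<And>i. i \<in> S \<Longrightarrow> 0 < w i\<close> by (simp add: add_pos_pos)
    have "(\<Prod>i\<in>S. w i / (u i + v i)) powr (1 / n) \<le> (\<Sum>i\<in>S. w i / (u i + v i) / n)"
      unfolding n_def by (rule arith_geom_mean) (use S pos in \<open>auto intro: less_imp_le\<close>)
    moreover have "0 < (\<Prod>i\<in>S. w i / (u i + v i))"
      by (rule prod_pos) (use pos in auto)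
    ultimately show ?thesis
      using n by (simp add: root_powr_inverse sum_divide_distrib)
  qed
  have quot: "root n (\<Prod>i\<in>S. w i / (u i + v i)) = root n (\<Prod>i\<in>S. w i) / root n (\<Prod>i\<in>S. u i + v i)" for w
    by (simp add: prod_dividef real_root_divide)
  have sum1: "(\<Sum>i\<in>S. u i / (u i + v i)) + (\<Sum>i\<in>S. v i / (u i + v i)) = n"
  proof -
    have "u i / (u i + v i) + v i / (u i + v i) = 1" if "i \<in> S" for i
      using u[OF that] v[OF that] by (simp flip: add_divide_distrib)
    then show ?thesis
      by (simp add: n_def flip: sum.distrib)
  qed
  have pos: "0 < root n (\<Prod>i\<in>S. u i + v i)"
    using n u v by (simp add: prod_pos add_pos_pos)
  have "root n (\<Prod>i\<in>S. u i) / root n (\<Prod>i\<in>S. u i + v i)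
      + root n (\<Prod>i\<in>S. v i) / root n (\<Prod>i\<in>S. u i + v i)
      \<le> (\<Sum>i\<in>S. u i / (u i + v i)) / n + (\<Sum>i\<in>S. v i / (u i + v i)) / n"
    using amgm[OF u] amgm[OF v] unfolding quot by (rule add_mono)
  also have "\<dots> = 1"
    using sum1 n by (simp flip: add_divide_distrib)
  finally show ?thesis
    using pos by (simp add: n_def field_simps)
qed

lemma root_sum_power_scale:
  assumes "0 \<le> t" "0 < n"
  shows "(root n (t * a) + root n (t * b)) ^ n = t * (root n a + root n b) ^ n"
proof -
  have "(root n (t * a) + root n (t * b)) ^ n = (root n t * (root n a + root n b)) ^ n"
    by (simp add: real_root_mult distrib_left)
  also have "\<dots> = t * (root n a + root n b) ^ n"
    using assms by (simp add: power_mult_distrib)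
  finally show ?thesis .
qed

lemma box_subset_plus_box:
  fixes a b c d :: "'a::euclidean_space"
  assumes "box a b \<noteq> {}" "box c d \<noteq> {}"
  shows "box (a + c) (b + d) \<subseteq> box a b + box c d"
proof
  fix x assume x: "x \<in> box (a + c) (b + d)"
  \<comment> \<open>In each coordinate, the midpoint of the interval of admissible values.\<close>
  define y where
    "y = (\<Sum>i\<in>Basis. ((max (a \<bullet> i) (x \<bullet> i - d \<bullet> i) + min (b \<bullet> i) (x \<bullet> i - c \<bullet> i)) / 2) *\<^sub>R i)"
  have y: "y \<bullet> i = (max (a \<bullet> i) (x \<bullet> i - d \<bullet> i) + min (b \<bullet> i) (x \<bullet> i - c \<bullet> i)) / 2"
    if "i \<in> Basis" for i
    using that by (simp add: y_def)
  have bnd: "a \<bullet> i < y \<bullet> i \<and> y \<bullet> i < b \<bullet> i \<and> c \<bullet> i < x \<bullet> i - y \<bullet> i \<and> x \<bullet> i - y \<bullet> i < d \<bullet> i"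
    if i: "i \<in> Basis" for i
  proof -
    have "a \<bullet> i < b \<bullet> i" "c \<bullet> i < d \<bullet> i"
      using assms i by (auto simp: box_ne_empty)
    moreover have "a \<bullet> i + c \<bullet> i < x \<bullet> i" "x \<bullet> i < b \<bullet> i + d \<bullet> i"
      using x i by (auto simp: mem_box inner_add_left)
    ultimately show ?thesis
      unfolding y[OF i] by (auto simp: max_def min_def field_simps)
  qed
  then have "y \<in> box a b" "x - y \<in> box c d"
    by (auto simp: mem_box inner_diff_left)
  then have "y + (x - y) \<in> box a b + box c d"
    by (rule set_plus_intro)
  then show "x \<in> box a b + box c d" by simp
qed

lemma open_set_plus:
  fixes A B :: "'a::real_normed_vector set"
  assumes "open B"
  shows "open (A + B)"
proof -
  have "A + B = (\<Union>a\<in>A. (+) a ` B)"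
    by (auto simp: set_plus_def)
  then show ?thesis
    using assms by (auto intro: open_translation)
qed

lemma bounded_set_plus:
  fixes A B :: "'a::real_normed_vector set"
  assumes "bounded A" "bounded B"
  shows "bounded (A + B)"
proof -
  have "A + B = (\<Union>x\<in>A. \<Union>y\<in>B. {x + y})"
    by (auto simp: set_plus_def)
  then show ?thesis
    using bounded_sums[OF assms] by simp
qed

lemma box_Int_halfspace:
  fixes a b :: "'a::euclidean_space"
  assumes "k \<in> Basis"
  shows "box a b \<inter> {x. x \<bullet> k < s} = box a (\<Sum>i\<in>Basis. (if i = k then min (b \<bullet> k) s else b \<bullet> i) *\<^sub>R i)"
    and "box a b \<inter> {x. s < x \<bullet> k} = box (\<Sum>i\<in>Basis. (if i = k then max (a \<bullet> k) s else a \<bullet> i) *\<^sub>R i) b"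
  using assms by (auto simp: mem_box set_eq_iff)

lemma measure_box_Int_halfspace:
  fixes a b :: "'a::euclidean_space"
  assumes k: "k \<in> Basis" and ne: "box a b \<noteq> {}"
  shows "measure lebesgue (box a b \<inter> {x. x \<bullet> k < s})
    = max 0 (min (b \<bullet> k) s - a \<bullet> k) * (\<Prod>i\<in>Basis - {k}. (b - a) \<bullet> i)"
proof -
  define b' where "b' = (\<Sum>i\<in>Basis. (if i = k then min (b \<bullet> k) s else b \<bullet> i) *\<^sub>R i)"
  have b': "b' \<bullet> i = (if i = k then min (b \<bullet> k) s else b \<bullet> i)" if "i \<in> Basis" for i
    using that by (simp add: b'_def)
  have lt: "a \<bullet> i < b \<bullet> i" if "i \<in> Basis" for i
    using ne that by (auto simp: box_ne_empty)
  have le: "(\<forall>i\<in>Basis. a \<bullet> i \<le> b' \<bullet> i) \<longleftrightarrow> a \<bullet> k \<le> min (b \<bullet> k) s"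
    using k lt b' by (auto intro: less_imp_le)
  have "(\<Prod>i\<in>Basis. (b' - a) \<bullet> i) = (b' - a) \<bullet> k * (\<Prod>i\<in>Basis - {k}. (b' - a) \<bullet> i)"
    using k by (simp add: prod.remove)
  also have "\<dots> = (min (b \<bullet> k) s - a \<bullet> k) * (\<Prod>i\<in>Basis - {k}. (b - a) \<bullet> i)"
    using k by (intro arg_cong2[where f = "(*)"] prod.cong) (auto simp: b' inner_diff_left)
  finally have prod: "(\<Prod>i\<in>Basis. (b' - a) \<bullet> i) = (min (b \<bullet> k) s - a \<bullet> k) * (\<Prod>i\<in>Basis - {k}. (b - a) \<bullet> i)" .
  have "measure lebesgue (box a b \<inter> {x. x \<bullet> k < s}) = measure lborel (box a b')"
    unfolding box_Int_halfspace[OF k] b'_def by simp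
  also have "\<dots> = max 0 (min (b \<bullet> k) s - a \<bullet> k) * (\<Prod>i\<in>Basis - {k}. (b - a) \<bullet> i)"
    unfolding measure_lborel_box_eq le prod by (auto simp: max_def)
  finally show ?thesis .
qed

text \<open>With open boxes the members can be disjoint sets, not merely nonoverlapping ones, and cutting by
  an open half-space again yields open boxes; only the hyperplane itself, a null set, is lost.\<close>
definition box_family :: "'a::euclidean_space set set \<Rightarrow> bool" where
  "box_family \<D> \<longleftrightarrow> finite \<D> \<and> (\<forall>D\<in>\<D>. D \<noteq> {} \<and> (\<exists>a b. D = box a b)) \<and> disjoint \<D>"

lemma box_familyE:
  assumes "box_family \<D>" "D \<in> \<D>"
  obtains a b where "D = box a b"
proof -
  have "\<exists>a b. D = box a b" using assms by (simp add: box_family_def)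
  with that show thesis by metis
qed

definition cut :: "'a set set \<Rightarrow> 'a set \<Rightarrow> 'a set set" where
  "cut \<D> H = (\<lambda>D. D \<inter> H) ` \<D> - {{}}"

lemma Union_cut: "\<Union>(cut \<D> H) = \<Union>\<D> \<inter> H"
  by (auto simp: cut_def)

lemma card_cut_le: "finite \<D> \<Longrightarrow> card (cut \<D> H) \<le> card \<D>"
  unfolding cut_def by (meson card_Diff1_le card_image_le le_trans finite_imageI)

text \<open>The induction on the number of boxes decreases because the cutting hyperplane leaves at
  least one whole box on either side.\<close>
lemma card_cut_less:
  assumes "finite \<D>" "D \<in> \<D>" "D \<inter> H = {}"
  shows "card (cut \<D> H) < card \<D>"
proof -
  have "cut \<D> H \<subseteq> (\<lambda>D. D \<inter> H) ` (\<D> - {D})"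
    using assms by (auto simp: cut_def)
  then have "card (cut \<D> H) \<le> card (\<D> - {D})"
    using assms by (meson card_image_le card_mono finite_Diff finite_imageI le_trans)
  also have "\<dots> < card \<D>"
    using assms by (intro card_Diff1_less)
  finally show ?thesis .
qed

lemma box_family_cut:
  assumes D: "box_family \<D>" and H: "\<And>a b. \<exists>c d. box a b \<inter> H = box c d"
  shows "box_family (cut \<D> H)"
proof -
  have "\<exists>a b. E = box a b" if "E \<in> cut \<D> H" for E
    using that D H unfolding cut_def box_family_def by (auto; metis)
  moreover have "disjoint (cut \<D> H)"
    using D unfolding box_family_def cut_def by (auto simp: disjoint_def)
  ultimately show ?thesis
    using D unfolding box_family_def cut_def by auto
qed

lemma box_family_cut_halfspace:
  assumes "box_family \<D>" "k \<in> Basis"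
  shows "box_family (cut \<D> {x. x \<bullet> k < s})" "box_family (cut \<D> {x. s < x \<bullet> k})"
  by (rule box_family_cut[OF assms(1)], use box_Int_halfspace[OF assms(2)] in blast)+

lemma box_family_Union:
  assumes "box_family \<D>"
  shows "open (\<Union>\<D>)" "bounded (\<Union>\<D>)" "\<Union>\<D> \<in> lmeasurable"
proof -
  show "open (\<Union>\<D>)" "bounded (\<Union>\<D>)"
    using assms by (auto simp: box_family_def intro!: bounded_Union open_Union)
  then show "\<Union>\<D> \<in> lmeasurable"
    by (rule lmeasurable_open[rotated])
qed

lemma measure_Union_box_family_pos:
  assumes "box_family \<D>" "\<D> \<noteq> {}"
  shows "0 < measure lebesgue (\<Union>\<D>)"
proof -
  have "\<Union>\<D> \<noteq> {}" using assms by (auto simp: box_family_def)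
  then have "\<not> negligible (\<Union>\<D>)"
    using box_family_Union(1)[OF assms(1)] open_not_negligible by blast
  then show ?thesis
    using box_family_Union(3)[OF assms(1)] by (simp add: negligible_iff_measure zero_less_measure_iff)
qed

lemma measure_halfspaces_add:
  fixes S :: "'a::euclidean_space set"
  assumes S: "S \<in> lmeasurable" and k: "k \<in> Basis"
  shows "measure lebesgue (S \<inter> {x. x \<bullet> k < s}) + measure lebesgue (S \<inter> {x. s < x \<bullet> k}) = measure lebesgue S"
proof -
  let ?L = "S \<inter> {x. x \<bullet> k < s}" and ?R = "S \<inter> {x. s < x \<bullet> k}"
  have "open {x. x \<bullet> k < s}" "open {x. s < x \<bullet> k}"
    by (simp_all add: open_halfspace_component_lt open_halfspace_component_gt)
  then have m: "?L \<in> lmeasurable" "?R \<in> lmeasurable"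
    using S by (auto intro!: fmeasurable_Int_fmeasurable)
  have "measure lebesgue (?L \<union> ?R) = measure lebesgue ?L + measure lebesgue ?R"
    by (rule measure_Un_AE) (use m in auto)
  moreover have "measure lebesgue (?L \<union> ?R) = measure lebesgue S"
    by (rule measure_negligible_symdiff[OF S], rule negligible_subset[OF negligible_standard_hyperplane[OF k, of s]])
      auto
  ultimately show ?thesis by simp
qed

text \<open>The volume cut off by a moving hyperplane is a finite sum of explicit continuous functions
  of the position of the hyperplane, so the intermediate value theorem applies.\<close>
lemma obtain_halfspace_fraction:
  assumes D: "box_family \<D>" and k: "k \<in> Basis" and \<theta>: "0 \<le> \<theta>" "\<theta> \<le> 1"
  obtains s where "measure lebesgue (\<Union>\<D> \<inter> {x. x \<bullet> k < s}) = \<theta> * measure lebesgue (\<Union>\<D>)"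
proof -
  define f where "f s = measure lebesgue (\<Union>\<D> \<inter> {x. x \<bullet> k < s})" for s
  have f_sum: "f s = (\<Sum>D\<in>\<D>. measure lebesgue (D \<inter> {x. x \<bullet> k < s}))" for s
  proof -
    have "f s = measure lebesgue (\<Union>D\<in>\<D>. D \<inter> {x. x \<bullet> k < s})"
      unfolding f_def by (rule arg_cong[where f = "measure lebesgue"]) auto
    also have "\<dots> = (\<Sum>D\<in>\<D>. measure lebesgue (D \<inter> {x. x \<bullet> k < s}))"
    proof (rule measure_negligible_finite_Union_image)
      show "finite \<D>" using D by (simp add: box_family_def)
      show "D \<inter> {x. x \<bullet> k < s} \<in> lmeasurable" if "D \<in> \<D>" for D
      proof -
        obtain a b where "D = box a b" by (rule box_familyE[OF D \<open>D \<in> \<D>\<close>])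
        then show ?thesis by (simp add: box_Int_halfspace[OF k])
      qed
      have "(D \<inter> {x. x \<bullet> k < s}) \<inter> (E \<inter> {x. x \<bullet> k < s}) = {}"
        if "D \<in> \<D>" "E \<in> \<D>" "D \<noteq> E" for D E
        using D that by (auto simp: box_family_def disjoint_def)
      then show "pairwise (\<lambda>D E. negligible ((D \<inter> {x. x \<bullet> k < s}) \<inter> (E \<inter> {x. x \<bullet> k < s}))) \<D>"
        by (simp add: pairwise_def)
    qed
    finally show ?thesis .
  qed
  have "continuous_on UNIV (\<lambda>s. measure lebesgue (D \<inter> {x. x \<bullet> k < s}))" if "D \<in> \<D>" for D
  proof -
    obtain a b where ab: "D = box a b"
      by (rule box_familyE[OF D \<open>D \<in> \<D>\<close>])
    then have ne: "box a b \<noteq> {}"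
      using D that by (auto simp: box_family_def)
    show ?thesis
      unfolding ab measure_box_Int_halfspace[OF k ne] by (intro continuous_intros)
  qed
  then have cont: "continuous_on UNIV f"
    unfolding f_sum by (intro continuous_on_sum)
  obtain M where M: "\<And>x. x \<in> \<Union>\<D> \<Longrightarrow> norm x \<le> M"
    using box_family_Union(2)[OF D] by (auto simp: bounded_iff)
  have M': "- M \<le> x \<bullet> k \<and> x \<bullet> k < M + 1" if "x \<in> \<Union>\<D>" for x
    using M[OF that] Basis_le_norm[OF k, of x] by linarith
  have "\<Union>\<D> \<inter> {x. x \<bullet> k < - M} = {}" "\<Union>\<D> \<inter> {x. x \<bullet> k < M + 1} = \<Union>\<D>"
    using M' by fastforce+
  then have f_ends: "f (- M) = 0" "f (M + 1) = measure lebesgue (\<Union>\<D>)"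
    unfolding f_def by (simp_all only: measure_empty)
  show ?thesis
  proof (cases "\<D> = {}")
    case True
    then show ?thesis using that by simp
  next
    case False
    then have "\<Union>\<D> \<noteq> {}" using D by (auto simp: box_family_def)
    then obtain x where "x \<in> \<Union>\<D>" by blast
    then have "- M \<le> M + 1" using M'[of x] by linarith
    moreover have "\<theta> * measure lebesgue (\<Union>\<D>) \<le> 1 * measure lebesgue (\<Union>\<D>)"
      using \<theta> by (intro mult_right_mono) auto
    moreover have "0 \<le> \<theta> * measure lebesgue (\<Union>\<D>)"
      using \<theta> by simp
    ultimately have "\<exists>s\<ge>- M. s \<le> M + 1 \<and> f s = \<theta> * measure lebesgue (\<Union>\<D>)"
      using f_ends cont by (intro IVT') (auto intro: continuous_on_subset)
    then show ?thesis using that unfolding f_def by blast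
  qed
qed

lemma separating_coordinate:
  fixes D E :: "'a::euclidean_space set"
  assumes "box_family \<D>" "D \<in> \<D>" "E \<in> \<D>" "D \<noteq> E"
  obtains k s D' E' where "k \<in> Basis" "D' \<in> \<D>" "E' \<in> \<D>" "D' \<subseteq> {x. x \<bullet> k < s}" "E' \<subseteq> {x. s < x \<bullet> k}"
proof -
  obtain a b where D: "D = box a b"
    using assms by (blast elim: box_familyE)
  obtain c d where E: "E = box c d"
    using assms by (blast elim: box_familyE)
  have ne: "box a b \<noteq> {}" "box c d \<noteq> {}" and "box a b \<inter> box c d = {}"
    using assms D E by (auto simp: box_family_def disjoint_def)
  then obtain k where k: "k \<in> Basis"
    and "b \<bullet> k \<le> a \<bullet> k \<or> d \<bullet> k \<le> c \<bullet> k \<or> b \<bullet> k \<le> c \<bullet> k \<or> d \<bullet> k \<le> a \<bullet> k"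
    by (auto simp: disjoint_interval)
  then consider "b \<bullet> k \<le> c \<bullet> k" | "d \<bullet> k \<le> a \<bullet> k"
    using ne by (force simp: box_ne_empty)
  then show ?thesis
  proof cases
    case 1
    show ?thesis
      by (rule that[OF k \<open>D \<in> \<D>\<close> \<open>E \<in> \<D>\<close>, of "b \<bullet> k"])
        (use 1 k in \<open>auto simp: D E mem_box intro: le_less_trans\<close>)
  next
    case 2
    show ?thesis
      by (rule that[OF k \<open>E \<in> \<D>\<close> \<open>D \<in> \<D>\<close>, of "d \<bullet> k"])
        (use 2 k in \<open>auto simp: D E mem_box intro: le_less_trans\<close>)
  qed
qed

text \<open>The Hadwiger--Ohmann induction. Cutting both unions in the same proportion \<open>\<theta>\<close> scales the
  lower bound by \<open>\<theta>\<close> for one pair of halves and by \<open>1 - \<theta>\<close> for the other, and the Minkowski sums of corresponding halves lie on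
  different sides of one hyperplane, so their volumes add up.\<close>
lemma brunn_minkowski_box_families:
  fixes \<D> \<E> :: "'a::euclidean_space set set"
  assumes "box_family \<D>" "\<D> \<noteq> {}" "box_family \<E>" "\<E> \<noteq> {}"
  shows "(root DIM('a) (measure lebesgue (\<Union>\<D>)) + root DIM('a) (measure lebesgue (\<Union>\<E>))) ^ DIM('a)
    \<le> measure lebesgue (\<Union>\<D> + \<Union>\<E>)"
  using assms
proof (induction "card \<D> + card \<E>" arbitrary: \<D> \<E> rule: less_induct)
  case less
  let ?n = "DIM('a)" and ?v = "measure lebesgue :: 'a set \<Rightarrow> real"
  \<comment> \<open>The inductive step, stated for an arbitrary order of the two families because either may be
    the one that contains two boxes.\<close>
  have split: "(root ?n (?v (\<Union>\<A>)) + root ?n (?v (\<Union>\<B>))) ^ ?n \<le> ?v (\<Union>\<A> + \<Union>\<B>)"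
    if A: "box_family \<A>" "A1 \<in> \<A>" "A2 \<in> \<A>" "A1 \<noteq> A2" and B: "box_family \<B>" "\<B> \<noteq> {}"
      and card: "card \<A> + card \<B> = card \<D> + card \<E>" for \<A> \<B> A1 A2
  proof -
    obtain k s A1' A2' where k: "k \<in> Basis" and A12: "A1' \<in> \<A>" "A2' \<in> \<A>"
      "A1' \<subseteq> {x. x \<bullet> k < s}" "A2' \<subseteq> {x. s < x \<bullet> k}"
      by (rule separating_coordinate[OF A])
    define L R where "L u = {x. x \<bullet> k < u}" and "R u = {x. u < x \<bullet> k}" for u
    have fam: "box_family (cut \<A> (L s))" "box_family (cut \<A> (R s))"
      "box_family (cut \<B> (L u))" "box_family (cut \<B> (R u))" for u
      using A B k by (auto simp: L_def R_def box_family_cut_halfspace)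
    have vA: "?v (\<Union>\<A> \<inter> L s) + ?v (\<Union>\<A> \<inter> R s) = ?v (\<Union>\<A>)"
      unfolding L_def R_def by (intro measure_halfspaces_add k box_family_Union A)
    have vB: "?v (\<Union>\<B> \<inter> L u) + ?v (\<Union>\<B> \<inter> R u) = ?v (\<Union>\<B>)" for u
      unfolding L_def R_def by (intro measure_halfspaces_add k box_family_Union B)
    have "A1' \<inter> L s \<noteq> {}" "A2' \<inter> R s \<noteq> {}"
      using A12 A(1) by (auto simp: L_def R_def box_family_def Int_absorb2)
    then have cutA: "cut \<A> (L s) \<noteq> {}" "cut \<A> (R s) \<noteq> {}"
      using A12 by (auto simp: cut_def)
    have posA: "0 < ?v (\<Union>\<A> \<inter> L s)" "0 < ?v (\<Union>\<A> \<inter> R s)"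
      using measure_Union_box_family_pos[OF fam(1) cutA(1)] measure_Union_box_family_pos[OF fam(2) cutA(2)]
      by (simp_all add: Union_cut)
    have posB: "0 < ?v (\<Union>\<B>)"
      by (rule measure_Union_box_family_pos[OF B])
    define \<theta> where "\<theta> = ?v (\<Union>\<A> \<inter> L s) / ?v (\<Union>\<A>)"
    have \<theta>: "0 < \<theta>" "\<theta> < 1"
      using posA vA by (auto simp: \<theta>_def)
    have \<theta>A: "?v (\<Union>\<A> \<inter> L s) = \<theta> * ?v (\<Union>\<A>)" "?v (\<Union>\<A> \<inter> R s) = (1 - \<theta>) * ?v (\<Union>\<A>)"
    proof -
      show L: "?v (\<Union>\<A> \<inter> L s) = \<theta> * ?v (\<Union>\<A>)"
        using posA vA by (simp add: \<theta>_def)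
      show "?v (\<Union>\<A> \<inter> R s) = (1 - \<theta>) * ?v (\<Union>\<A>)"
        using vA L by (simp add: left_diff_distrib)
    qed
    obtain u where u: "?v (\<Union>\<B> \<inter> L u) = \<theta> * ?v (\<Union>\<B>)"
      unfolding L_def using obtain_halfspace_fraction[OF B(1) k, of \<theta>] \<theta> by auto
    then have u': "?v (\<Union>\<B> \<inter> R u) = (1 - \<theta>) * ?v (\<Union>\<B>)"
      using vB[of u] by (simp add: algebra_simps)
    have "?v (\<Union>(cut \<B> (L u))) \<noteq> 0" "?v (\<Union>(cut \<B> (R u))) \<noteq> 0"
      using u u' \<theta> posB by (auto simp: Union_cut)
    then have cutB: "cut \<B> (L u) \<noteq> {}" "cut \<B> (R u) \<noteq> {}"
      by auto
    have fin: "finite \<A>" "finite \<B>"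
      using A B by (auto simp: box_family_def)
    have "A2' \<inter> L s = {}" "A1' \<inter> R s = {}"
      using A12 by (fastforce simp: L_def R_def)+
    then have cards: "card (cut \<A> (L s)) < card \<A>" "card (cut \<A> (R s)) < card \<A>"
      using card_cut_less[OF fin(1)] A12 by auto
    have "(root ?n (?v (\<Union>(cut \<A> (L s)))) + root ?n (?v (\<Union>(cut \<B> (L u))))) ^ ?n
        \<le> ?v (\<Union>(cut \<A> (L s)) + \<Union>(cut \<B> (L u)))"
      by (rule less.hyps) (use cards card card_cut_le[OF fin(2), of "L u"] fam cutA cutB in auto)
    moreover have "(root ?n (?v (\<Union>(cut \<A> (R s)))) + root ?n (?v (\<Union>(cut \<B> (R u))))) ^ ?n
        \<le> ?v (\<Union>(cut \<A> (R s)) + \<Union>(cut \<B> (R u)))"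
      by (rule less.hyps) (use cards card card_cut_le[OF fin(2), of "R u"] fam cutA cutB in auto)
    ultimately have IH:
      "(root ?n (\<theta> * ?v (\<Union>\<A>)) + root ?n (\<theta> * ?v (\<Union>\<B>))) ^ ?n
        \<le> ?v (\<Union>(cut \<A> (L s)) + \<Union>(cut \<B> (L u)))"
      "(root ?n ((1 - \<theta>) * ?v (\<Union>\<A>)) + root ?n ((1 - \<theta>) * ?v (\<Union>\<B>))) ^ ?n
        \<le> ?v (\<Union>(cut \<A> (R s)) + \<Union>(cut \<B> (R u)))"
      unfolding Union_cut u u' \<theta>A by auto
    define P Q where "P = \<Union>(cut \<A> (L s)) + \<Union>(cut \<B> (L u))" and "Q = \<Union>(cut \<A> (R s)) + \<Union>(cut \<B> (R u))"
    have sub: "P \<subseteq> L (s + u)" "Q \<subseteq> R (s + u)"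
      unfolding P_def Q_def Union_cut by (auto simp: set_plus_def L_def R_def inner_add_left)
    have PQ: "P \<in> lmeasurable" "Q \<in> lmeasurable"
      unfolding P_def Q_def
      by (auto intro!: lmeasurable_open bounded_set_plus open_set_plus simp only: box_family_Union[OF fam(1)]
          box_family_Union[OF fam(2)] box_family_Union[OF fam(3)] box_family_Union[OF fam(4)])
    have AB: "\<Union>\<A> + \<Union>\<B> \<in> lmeasurable"
      by (intro lmeasurable_open bounded_set_plus open_set_plus box_family_Union A B)
    have "(root ?n (?v (\<Union>\<A>)) + root ?n (?v (\<Union>\<B>))) ^ ?n \<le> ?v P + ?v Q"
      using IH[folded P_def Q_def] root_sum_power_scale[of \<theta>] root_sum_power_scale[of "1 - \<theta>"] \<theta>
      by (simp add: left_diff_distrib)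
    also have "\<dots> = ?v (P \<union> Q)"
      by (rule measure_Un_AE[symmetric]) (use PQ sub in \<open>fastforce simp: L_def R_def\<close>)+
    also have "\<dots> \<le> ?v (\<Union>\<A> + \<Union>\<B>)"
      by (rule measure_mono_fmeasurable[OF _ _ AB])
        (use PQ in \<open>auto simp: P_def Q_def Union_cut set_plus_def\<close>)
    finally show ?thesis .
  qed
  consider (left) A1 A2 where "A1 \<in> \<D>" "A2 \<in> \<D>" "A1 \<noteq> A2"
    | (right) A1 A2 where "A1 \<in> \<E>" "A2 \<in> \<E>" "A1 \<noteq> A2"
    | (single) A B where "\<D> = {A}" "\<E> = {B}"
    using less.prems by (metis is_singletonI' is_singleton_the_elem)
  then show ?case
  proof cases
    case left
    then show ?thesis
      using split less.prems by blast
  next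
    case right
    then show ?thesis
      using split[of \<E> A1 A2 \<D>] less.prems by (simp add: add.commute)
  next
    case single
    obtain a b where A: "A = box a b"
      using single less.prems by (blast elim: box_familyE)
    obtain c d where B: "B = box c d"
      using single less.prems by (blast elim: box_familyE)
    have ne: "box a b \<noteq> {}" "box c d \<noteq> {}"
      using single less.prems A B by (auto simp: box_family_def)
    have ab: "a \<bullet> i < b \<bullet> i" and cd: "c \<bullet> i < d \<bullet> i" if "i \<in> Basis" for i
      using ne that by (auto simp: box_ne_empty)
    have vol_AB: "?v A = (\<Prod>i\<in>Basis. (b - a) \<bullet> i)" "?v B = (\<Prod>i\<in>Basis. (d - c) \<bullet> i)"
      using ab cd by (simp_all add: A B less_imp_le)
    have "box (a + c) (b + d) \<subseteq> A + B"
      unfolding A B by (rule box_subset_plus_box[OF ne])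
    moreover have "A + B \<in> lmeasurable"
      unfolding A B by (intro lmeasurable_open bounded_set_plus open_set_plus) auto
    ultimately have le: "?v (box (a + c) (b + d)) \<le> ?v (A + B)"
      by (intro measure_mono_fmeasurable) auto
    have "?v (box (a + c) (b + d)) = (\<Prod>i\<in>Basis. (b - a) \<bullet> i + (d - c) \<bullet> i)"
      using ab cd by (simp add: inner_simps add_mono less_imp_le) (simp add: algebra_simps)
    then have prod_le: "(\<Prod>i\<in>Basis. (b - a) \<bullet> i + (d - c) \<bullet> i) \<le> ?v (A + B)"
      using le by simp
    have "root ?n (?v A) + root ?n (?v B) \<le> root ?n (\<Prod>i\<in>Basis. (b - a) \<bullet> i + (d - c) \<bullet> i)"
      unfolding vol_AB by (rule root_prod_superadditive) (use ab cd in \<open>auto simp: inner_diff_left\<close>)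
    also have "\<dots> \<le> root ?n (?v (A + B))"
      using prod_le by simp
    finally have "(root ?n (?v A) + root ?n (?v B)) ^ ?n \<le> root ?n (?v (A + B)) ^ ?n"
      by (rule power_mono) (simp add: add_nonneg_nonneg)
    then show ?thesis
      by (simp add: single)
  qed
qed

section \<open>The Brunn--Minkowski inequality for convex sets\<close>

text \<open>An open set is a countable union of closed boxes. Finitely many of these exhaust the volume up to
  the factor \<open>t\<close>, and a division of their union provides disjoint open boxes after
  passing to interiors.\<close>
lemma inner_box_family_approx:
  fixes U :: "'a::euclidean_space set"
  assumes U: "open U" "bounded U" "U \<noteq> {}" and t: "0 < t" "t < 1"
  obtains \<D> where "box_family \<D>" "\<D> \<noteq> {}" "\<Union>\<D> \<subseteq> U" "t * measure lebesgue U \<le> measure lebesgue (\<Union>\<D>)"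
proof -
  let ?v = "measure lebesgue :: 'a set \<Rightarrow> real"
  have mU: "U \<in> lmeasurable" using U by (simp add: lmeasurable_open)
  have "\<not> negligible U" using U open_not_negligible by blast
  then have vU: "0 < ?v U" using mU by (simp add: negligible_iff_measure zero_less_measure_iff)
  obtain \<C> where \<C>: "countable \<C>" "\<And>X. X \<in> \<C> \<Longrightarrow> \<exists>a b. X = cbox a b" "\<Union>\<C> = U"
    using open_countable_Union_open_cbox[OF U(1)] by metis
  have ne: "\<C> \<noteq> {}" using \<C> U by auto
  define F where "F n = \<Union>(from_nat_into \<C> ` {..<n})" for n
  have FU: "F n \<subseteq> U" for n
    using \<C>(3) from_nat_into[OF ne] by (auto simp: F_def)
  have cb: "\<exists>a b. X = cbox a b" if "X \<in> from_nat_into \<C> ` {..<n}" for X n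
    using that \<C>(2) from_nat_into[OF ne] by auto
  have mF: "F n \<in> lmeasurable" for n
    unfolding F_def
  proof (rule fmeasurable.finite_Union)
    show "from_nat_into \<C> ` {..<n} \<subseteq> lmeasurable"
    proof
      fix X assume "X \<in> from_nat_into \<C> ` {..<n}"
      from cb[OF this] show "X \<in> lmeasurable" by (elim exE) simp
    qed
  qed simp
  have "(\<lambda>n. ?v (F n)) \<longlonglongrightarrow> ?v (\<Union>n. F n)"
  proof (rule measure_nested_Union[OF mF])
    show "?v (F n) \<le> ?v U" for n
      by (rule measure_mono_fmeasurable[OF FU _ mU]) (use mF in auto)
    show "F n \<subseteq> F (Suc n)" for n
      by (auto simp: F_def lessThan_Suc)
  qed
  moreover have "(\<Union>n. F n) = U"
  proof -
    have "(\<Union>n. F n) = \<Union>(range (from_nat_into \<C>))"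
      by (auto simp: F_def)
    then show ?thesis
      using \<C> ne by (simp add: range_from_nat_into)
  qed
  ultimately have lim: "(\<lambda>n. ?v (F n)) \<longlonglongrightarrow> ?v U" by simp
  have "t * ?v U < ?v U" using t vU by simp
  then have "\<forall>\<^sub>F n in sequentially. t * ?v U < ?v (F n)"
    using lim by (rule order_tendstoD(1)[rotated])
  then obtain n where n: "t * ?v U < ?v (F n)"
    by (metis eventually_sequentially order_refl)
  obtain p where p: "p division_of (F n)"
    unfolding F_def by (rule elementary_unions_intervals[of "from_nat_into \<C> ` {..<n}"]) (use cb in auto)
  define \<D> where "\<D> = interior ` p - {{}}"
  have int: "\<exists>a b. interior X = box a b" if "X \<in> p" for X
    using division_ofD(4)[OF p that] interior_cbox by metis
  have fam: "box_family \<D>"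
    unfolding box_family_def
  proof (intro conjI)
    show "finite \<D>" using p by (auto simp: \<D>_def)
    show "\<forall>D\<in>\<D>. D \<noteq> {} \<and> (\<exists>a b. D = box a b)"
      using int by (auto simp: \<D>_def)
    show "disjoint \<D>"
    proof (rule disjointI)
      fix D E assume "D \<in> \<D>" "E \<in> \<D>" "D \<noteq> E"
      then obtain X Y where "X \<in> p" "Y \<in> p" "D = interior X" "E = interior Y" "X \<noteq> Y"
        unfolding \<D>_def by blast
      then show "D \<inter> E = {}" using division_ofD(5)[OF p] by metis
    qed
  qed
  have UD: "\<Union>\<D> = (\<Union>X\<in>p. interior X)" by (auto simp: \<D>_def)
  have sub: "\<Union>\<D> \<subseteq> F n"
    unfolding UD division_ofD(6)[OF p, symmetric] using interior_subset by fast
  have "negligible (\<Union>X\<in>p. X - interior X)"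
  proof (rule negligible_Union)
    show "finite ((\<lambda>X. X - interior X) ` p)" using p by auto
    fix T assume "T \<in> (\<lambda>X. X - interior X) ` p"
    then obtain X where "X \<in> p" "T = X - interior X" by blast
    then show "negligible T"
      using division_ofD(4)[OF p] negligible_frontier_interval interior_cbox by metis
  qed
  then have "negligible ((F n - \<Union>\<D>) \<union> (\<Union>\<D> - F n))"
    by (rule negligible_subset) (use sub in \<open>auto simp: UD division_ofD(6)[OF p, symmetric]\<close>)
  then have eq: "?v (\<Union>\<D>) = ?v (F n)"
    by (rule measure_negligible_symdiff[OF mF])
  have "0 < t * ?v U" using t vU by simp
  then have "\<D> \<noteq> {}" using n eq by auto
  with fam sub FU n eq show ?thesis by (intro that[of \<D>]) auto
qed

text \<open>Both sides are homogeneous in the volumes, hence a multiplicative approximation loses just the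
  factor \<open>t\<close>, which may be taken arbitrarily close to \<open>1\<close>.\<close>
lemma brunn_minkowski_open:
  fixes A B :: "'a::euclidean_space set"
  assumes A: "open A" "bounded A" "A \<noteq> {}" and B: "open B" "bounded B" "B \<noteq> {}"
  shows "(root DIM('a) (measure lebesgue A) + root DIM('a) (measure lebesgue B)) ^ DIM('a)
    \<le> measure lebesgue (A + B)"
proof (rule field_le_mult_one_interval)
  fix t :: real assume t: "0 < t" "t < 1"
  let ?n = "DIM('a)" and ?v = "measure lebesgue :: 'a set \<Rightarrow> real"
  obtain \<D> where D: "box_family \<D>" "\<D> \<noteq> {}" "\<Union>\<D> \<subseteq> A" "t * ?v A \<le> ?v (\<Union>\<D>)"
    by (rule inner_box_family_approx[OF A t])
  obtain \<E> where E: "box_family \<E>" "\<E> \<noteq> {}" "\<Union>\<E> \<subseteq> B" "t * ?v B \<le> ?v (\<Union>\<E>)"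
    by (rule inner_box_family_approx[OF B t])
  have "t * (root ?n (?v A) + root ?n (?v B)) ^ ?n = (root ?n (t * ?v A) + root ?n (t * ?v B)) ^ ?n"
    using t by (simp add: root_sum_power_scale)
  also have "\<dots> \<le> (root ?n (?v (\<Union>\<D>)) + root ?n (?v (\<Union>\<E>))) ^ ?n"
    by (intro power_mono add_mono add_nonneg_nonneg) (use D E t in auto)
  also have "\<dots> \<le> ?v (\<Union>\<D> + \<Union>\<E>)"
    by (rule brunn_minkowski_box_families[OF D(1,2) E(1,2)])
  also have "\<dots> \<le> ?v (A + B)"
  proof (rule measure_mono_fmeasurable)
    show "\<Union>\<D> + \<Union>\<E> \<subseteq> A + B" using D E by (intro set_plus_mono2)
    have "\<Union>\<D> + \<Union>\<E> \<in> lmeasurable"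
      by (intro lmeasurable_open bounded_set_plus open_set_plus box_family_Union D E)
    then show "\<Union>\<D> + \<Union>\<E> \<in> sets lebesgue" by (rule fmeasurableD)
    show "A + B \<in> lmeasurable"
      by (intro lmeasurable_open bounded_set_plus open_set_plus A B)
  qed
  finally show "t * (root ?n (?v A) + root ?n (?v B)) ^ ?n \<le> ?v (A + B)" .
qed

text \<open>A bounded convex set has the same volume as its interior. If one of the interiors is
  empty, the sum still contains a translate of the other set.\<close>
theorem brunn_minkowski_convex:
  fixes A B :: "'a::euclidean_space set"
  assumes A: "convex A" "bounded A" "A \<noteq> {}" and B: "convex B" "bounded B" "B \<noteq> {}"
  shows "(root DIM('a) (measure lebesgue A) + root DIM('a) (measure lebesgue B)) ^ DIM('a)
    \<le> measure lebesgue (A + B)"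
proof -
  let ?v = "measure lebesgue :: 'a set \<Rightarrow> real"
  have AB: "A + B \<in> lmeasurable"
    by (intro measurable_convex convex_set_plus bounded_set_plus A B)
  have mA: "A \<in> lmeasurable" and mB: "B \<in> lmeasurable"
    using A B by (auto intro: measurable_convex)
  have translate: "?v X \<le> ?v (Y + X)" if "Y \<noteq> {}" "Y + X \<in> lmeasurable" "X \<in> lmeasurable" for X Y
  proof -
    obtain y where "y \<in> Y" using \<open>Y \<noteq> {}\<close> by blast
    then have "(+) y ` X \<subseteq> Y + X" by (auto simp: set_plus_def)
    then have "?v ((+) y ` X) \<le> ?v (Y + X)"
      by (rule measure_mono_fmeasurable) (use that measurable_translation in \<open>auto intro: fmeasurableD\<close>)
    then show ?thesis by (simp add: measure_translation)
  qed
  have int: "?v (interior X) = ?v X" if "convex X" "bounded X" for X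
    using that by (intro measure_interior negligible_convex_frontier)
  consider "?v A = 0" | "?v B = 0" | "interior A \<noteq> {}" "interior B \<noteq> {}"
    using int[OF A(1,2)] int[OF B(1,2)] by force
  then show ?thesis
  proof cases
    case 1
    then show ?thesis using translate[of A B] A AB mB by simp
  next
    case 2
    then show ?thesis using translate[of B A] B AB mA by (simp add: add.commute)
  next
    case 3
    have bdd: "bounded (interior A)" "bounded (interior B)"
      using A B interior_subset bounded_subset by blast+
    have "(root DIM('a) (?v A) + root DIM('a) (?v B)) ^ DIM('a) \<le> ?v (interior A + interior B)"
      using brunn_minkowski_open[OF open_interior bdd(1) 3(1) open_interior bdd(2) 3(2)]
      unfolding int[OF A(1,2)] int[OF B(1,2)] .
    also have "\<dots> \<le> ?v (A + B)"
    proof (rule measure_mono_fmeasurable[OF _ _ AB])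
      show "interior A + interior B \<subseteq> A + B" by (intro set_plus_mono2 interior_subset)
      have "interior A + interior B \<in> lmeasurable"
        by (intro lmeasurable_open bounded_set_plus open_set_plus bdd) simp
      then show "interior A + interior B \<in> sets lebesgue" by (rule fmeasurableD)
    qed
    finally show ?thesis .
  qed
qed

section \<open>The norm generated by a symmetric convex body\<close>

lemma measure_mono_compact:
  fixes S T :: "'a::euclidean_space set"
  assumes "S \<subseteq> T" "compact S" "compact T"
  shows "measure lebesgue S \<le> measure lebesgue T"
  using assms by (meson fmeasurableD lmeasurable_compact measure_mono_fmeasurable)

lemma K_ball_iff: "y \<in> K_ball K x r \<longleftrightarrow> y - x \<in> (*\<^sub>R) r ` K"
  unfolding K_ball_def by (auto simp: image_iff) (metis add_diff_cancel_left' diff_add_cancel add.commute)+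

lemma K_ball_body_iff: "x \<in> K_ball_body K r X \<longleftrightarrow> (\<forall>y\<in>X. x - y \<in> (*\<^sub>R) r ` K)"
  by (simp add: K_ball_body_def K_ball_iff)

lemma K_ball_eq_translate: "K_ball K x r = (+) x ` K_ball K 0 r"
  by (simp add: K_ball_def image_image)

locale symmetric_convex_body =
  fixes K :: "(real ^ 'n) set"
  assumes convex_body: "convex_body K" and o_symmetric: "o_symmetric K"
begin

lemma compact_K: "compact K" and convex_K: "convex K" and interior_K: "interior K \<noteq> {}"
  using convex_body by (auto simp: convex_body_def)

lemma uminus_K: "x \<in> K \<Longrightarrow> - x \<in> K"
  using o_symmetric unfolding o_symmetric_def by (metis image_eqI)

lemma zero_in_K: "0 \<in> K"
proof -
  obtain x where "x \<in> K" using interior_K interior_subset by blast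
  then have "(1/2) *\<^sub>R x + (1/2) *\<^sub>R (- x) \<in> K"
    by (intro convexD[OF convex_K] uminus_K) auto
  then show ?thesis by simp
qed

lemma zero_in_interior_K: "0 \<in> interior K"
proof -
  obtain x where x: "x \<in> interior K" using interior_K by blast
  have "uminus ` interior K = interior K"
    using interior_negations[of K] o_symmetric by (simp add: o_symmetric_def)
  then have "- x \<in> interior K" using x by (metis image_eqI)
  then have "(1/2) *\<^sub>R x + (1/2) *\<^sub>R (- x) \<in> interior K"
    using x by (intro convexD[OF convex_interior[OF convex_K]]) auto
  then show ?thesis by simp
qed

lemma zero_in_scaled: "0 \<in> (*\<^sub>R) r ` K"
  using zero_in_K by (metis image_eqI scaleR_zero_right)

lemma uminus_scaled: "x \<in> (*\<^sub>R) r ` K \<Longrightarrow> - x \<in> (*\<^sub>R) r ` K"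
  using uminus_K by (metis (no_types, lifting) image_iff scaleR_minus_right)

lemma scaled_add:
  assumes "0 \<le> a" "0 \<le> b" "x \<in> (*\<^sub>R) a ` K" "y \<in> (*\<^sub>R) b ` K"
  shows "x + y \<in> (*\<^sub>R) (a + b) ` K"
proof (cases "a + b = 0")
  case True
  then have "a = 0" "b = 0" using assms by auto
  then show ?thesis using assms zero_in_K by auto
next
  case False
  then have pos: "0 < a + b" using assms by simp
  obtain u v where u: "u \<in> K" "x = a *\<^sub>R u" and v: "v \<in> K" "y = b *\<^sub>R v"
    using assms by blast
  have "(a / (a + b)) *\<^sub>R u + (b / (a + b)) *\<^sub>R v \<in> K"
    using pos assms by (intro convexD[OF convex_K] u v) (auto simp flip: add_divide_distrib)
  moreover have "x + y = (a + b) *\<^sub>R ((a / (a + b)) *\<^sub>R u + (b / (a + b)) *\<^sub>R v)"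
    using pos by (simp add: u v scaleR_add_right)
  ultimately show ?thesis by blast
qed

lemma scaled_mono: "0 \<le> a \<Longrightarrow> a \<le> b \<Longrightarrow> x \<in> (*\<^sub>R) a ` K \<Longrightarrow> x \<in> (*\<^sub>R) b ` K"
  using scaled_add[of a "b - a" x 0] zero_in_scaled by simp

lemma compact_scaled: "compact ((*\<^sub>R) r ` K)" and convex_scaled: "convex ((*\<^sub>R) r ` K)"
  using compact_scaling[OF compact_K] convex_scaling[OF convex_K] by auto

lemma compact_K_ball: "compact (K_ball K x r)" and convex_K_ball: "convex (K_ball K x r)"
  unfolding K_ball_def by (intro compact_translation compact_scaled convex_translation convex_scaled)+

lemma vol_K_ball: "0 \<le> r \<Longrightarrow> vol (K_ball K x r) = r ^ CARD('n) * vol K"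
  unfolding K_ball_def using measure_lebesgue_affine[of r 0 K]
  by (simp add: measure_translation DIM_cart)

lemma vol_K_pos: "0 < vol K"
proof -
  have "\<not> negligible K"
    using negligible_convex_interior[OF convex_K] interior_K by simp
  then show ?thesis
    using lmeasurable_compact[OF compact_K] by (simp add: negligible_iff_measure zero_less_measure_iff)
qed

lemma vol_radius_unique:
  assumes "0 < \<rho>" "vol A = \<rho> ^ CARD('n) * vol K"
  shows "vol_radius K A = \<rho>"
  unfolding vol_radius_def
proof (rule the_equality)
  show "0 < \<rho> \<and> vol A = vol (K_ball K 0 \<rho>)"
    using assms by (simp add: vol_K_ball)
  fix \<sigma> assume \<sigma>: "0 < \<sigma> \<and> vol A = vol (K_ball K 0 \<sigma>)"
  then have "\<sigma> ^ CARD('n) = \<rho> ^ CARD('n)"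
    using assms vol_K_pos vol_K_ball[of \<sigma> 0] by simp
  then show "\<sigma> = \<rho>"
    using \<sigma> assms by (metis power_eq_imp_eq_base less_imp_le zero_less_card_finite)
qed

lemma vol_radius:
  assumes "0 < vol A"
  shows "0 < vol_radius K A" and "vol A = vol_radius K A ^ CARD('n) * vol K"
proof -
  define \<rho> where "\<rho> = root CARD('n) (vol A / vol K)"
  have \<rho>: "0 < \<rho>" "vol A = \<rho> ^ CARD('n) * vol K"
    using assms vol_K_pos by (simp_all add: \<rho>_def)
  then have "vol_radius K A = \<rho>"
    by (rule vol_radius_unique)
  with \<rho> show "0 < vol_radius K A" "vol A = vol_radius K A ^ CARD('n) * vol K"
    by auto
qed

text \<open>The factors \<open>\<mu>\<close> in question are bounded away from \<open>0\<close>, so that \<open>\<mu> \<mapsto> x /\<^sub>R \<mu>\<close> is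
  continuous there.\<close>
lemma closed_scale_set:
  assumes x: "x \<noteq> 0"
  shows "closed {\<mu>. 0 \<le> \<mu> \<and> x \<in> (*\<^sub>R) \<mu> ` K}"
proof -
  obtain M where M: "0 < M" "\<And>y. y \<in> K \<Longrightarrow> norm y \<le> M"
    using compact_imp_bounded[OF compact_K] bounded_pos by metis
  have bound: "norm x / M \<le> \<mu>" if "0 \<le> \<mu>" "x \<in> (*\<^sub>R) \<mu> ` K" for \<mu>
  proof -
    obtain y where "y \<in> K" "x = \<mu> *\<^sub>R y" using \<open>x \<in> (*\<^sub>R) \<mu> ` K\<close> by blast
    then have "norm x \<le> \<mu> * M" using M(2) that by (simp add: mult_left_mono)
    then show ?thesis using M(1) by (simp add: divide_le_eq)
  qed
  have pos: "0 < norm x / M" using x M by simp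
  have scaled: "x \<in> (*\<^sub>R) \<mu> ` K \<longleftrightarrow> x /\<^sub>R \<mu> \<in> K" if "\<mu> > 0" for \<mu>
    using that by (force simp: image_iff)
  have "{\<mu>. 0 \<le> \<mu> \<and> x \<in> (*\<^sub>R) \<mu> ` K} = {norm x / M..} \<inter> (\<lambda>\<mu>. x /\<^sub>R \<mu>) -` K"
  proof (rule set_eqI)
    fix \<mu>
    show "\<mu> \<in> {\<mu>. 0 \<le> \<mu> \<and> x \<in> (*\<^sub>R) \<mu> ` K} \<longleftrightarrow> \<mu> \<in> {norm x / M..} \<inter> (\<lambda>\<mu>. x /\<^sub>R \<mu>) -` K"
    proof (cases "norm x / M \<le> \<mu>")
      case True
      then have "0 < \<mu>" using pos by linarith
      with True scaled show ?thesis by simp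
    next
      case False
      with bound show ?thesis by auto
    qed
  qed
  moreover have "closed ({norm x / M..} \<inter> (\<lambda>\<mu>. x /\<^sub>R \<mu>) -` K)"
    using pos by (intro continuous_closed_preimage continuous_intros compact_imp_closed[OF compact_K]) auto
  ultimately show ?thesis by simp
qed

text \<open>The admissible factors form a nonempty closed set of nonnegative reals, so the minimum in the
  definition of the norm is attained.\<close>
lemma K_norm_attained: "0 \<le> K_norm K x" "x \<in> (*\<^sub>R) (K_norm K x) ` K"
  and K_norm_least: "0 \<le> \<mu> \<Longrightarrow> x \<in> (*\<^sub>R) \<mu> ` K \<Longrightarrow> K_norm K x \<le> \<mu>"
proof -
  define S where "S = {\<mu>. 0 \<le> \<mu> \<and> x \<in> (*\<^sub>R) \<mu> ` K}"
  have least: "\<exists>m\<in>S. \<forall>\<mu>\<in>S. m \<le> \<mu>"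
  proof (cases "x = 0")
    case True
    then show ?thesis by (intro bexI[of _ 0]) (auto simp: S_def zero_in_scaled)
  next
    case False
    obtain e where e: "0 < e" "cball 0 e \<subseteq> K"
      using zero_in_interior_K by (auto simp: mem_interior_cball)
    have "(norm x / e) *\<^sub>R ((e / norm x) *\<^sub>R x) = x" "(e / norm x) *\<^sub>R x \<in> K"
      using False e by auto
    then have "x \<in> (*\<^sub>R) (norm x / e) ` K" by (metis image_eqI)
    then have "norm x / e \<in> S" using e by (simp add: S_def)
    then have ne: "S \<noteq> {}" by auto
    have bdd: "bdd_below S" by (auto simp: S_def bdd_below_def)
    have "Inf S \<in> S"
      using closed_contains_Inf[OF ne bdd] closed_scale_set[OF False] by (simp add: S_def)
    then show ?thesis using cInf_lower[OF _ bdd] by blast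
  qed
  then obtain m where m: "m \<in> S" "\<And>\<mu>. \<mu> \<in> S \<Longrightarrow> m \<le> \<mu>" by blast
  have "K_norm K x = m"
    unfolding K_norm_def by (rule Least_equality) (use m in \<open>auto simp: S_def\<close>)
  with m show "0 \<le> K_norm K x" "x \<in> (*\<^sub>R) (K_norm K x) ` K"
    "0 \<le> \<mu> \<Longrightarrow> x \<in> (*\<^sub>R) \<mu> ` K \<Longrightarrow> K_norm K x \<le> \<mu>"
    by (auto simp: S_def)
qed

lemma K_norm_le_iff: "0 \<le> l \<Longrightarrow> K_norm K x \<le> l \<longleftrightarrow> x \<in> (*\<^sub>R) l ` K"
  using K_norm_attained K_norm_least scaled_mono by blast

lemma compact_K_ball_body: "X \<noteq> {} \<Longrightarrow> compact (K_ball_body K r X)"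
  unfolding K_ball_body_def
  by (rule compact_Inter) (auto simp: compact_K_ball)

lemma convex_K_ball_body: "convex (K_ball_body K r X)"
  unfolding K_ball_body_def by (intro convex_INT convex_K_ball)

end

section \<open>Generating balls are volumetric maximizers\<close>

text \<open>If \<open>z\<close> were outside \<open>C\<close>, take a functional separating \<open>z\<close> strictly from \<open>C\<close> and the point of \<open>X\<close>
  where it is minimal: translating that point by \<open>z\<close> leaves \<open>X + C\<close>.\<close>
lemma set_plus_cancel_translate:
  fixes X C :: "'a::euclidean_space set"
  assumes X: "compact X" "X \<noteq> {}" and C: "convex C" "closed C" and sub: "\<And>x. x \<in> X \<Longrightarrow> x + z \<in> X + C"
  shows "z \<in> C"
proof (rule ccontr)
  assume "z \<notin> C"
  then obtain a b where ab: "a \<bullet> z < b" "\<And>c. c \<in> C \<Longrightarrow> b < a \<bullet> c"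
    using separating_hyperplane_closed_point[OF C] by blast
  have cont: "continuous_on X ((\<bullet>) a)"
    by (intro continuous_intros)
  obtain x where x: "x \<in> X" "\<And>y. y \<in> X \<Longrightarrow> a \<bullet> x \<le> a \<bullet> y"
    using continuous_attains_inf[OF X cont] by blast
  obtain y c where "y \<in> X" "c \<in> C" "x + z = y + c"
    using sub[OF x(1)] by (auto elim: set_plus_elim)
  then have "a \<bullet> x + a \<bullet> z = a \<bullet> y + a \<bullet> c" by (metis inner_add_right)
  with x(2)[OF \<open>y \<in> X\<close>] ab(2)[OF \<open>c \<in> C\<close>] ab(1) show False by linarith
qed

context symmetric_convex_body
begin

text \<open>Brunn--Minkowski applied to \<open>X + C = r K\<close>, where \<open>X\<close> is the ball body of \<open>A\<close> and the complementary summand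
  \<open>C\<close> contains \<open>- A\<close>.\<close>
lemma volumetric_maximizers_if_generating:
  assumes gen: "\<And>r. 0 < r \<Longrightarrow> generating_set (K_ball K 0 r)"
  shows "balls_volumetric_maximizers K"
  unfolding balls_volumetric_maximizers_def
proof (intro allI impI, elim conjE)
  fix A :: "(real ^ 'n) set" and r
  let ?n = "CARD('n)"
  assume A: "A \<noteq> {}" "compact A" "0 < vol A" and r: "vol_radius K A < r"
  define \<rho> where "\<rho> = vol_radius K A"
  have \<rho>: "0 < \<rho>" "vol A = \<rho> ^ ?n * vol K" "\<rho> < r"
    using vol_radius[OF A(3)] r by (auto simp: \<rho>_def)
  define X where "X = K_ball_body K r A"
  show "vol (K_ball_body K r A) \<le> vol (K_ball K 0 (r - vol_radius K A))"
  proof (cases "X = {}")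
    case True
    then show ?thesis by (simp add: X_def)
  next
    case False
    have X: "compact X" "convex X"
      using A by (auto simp: X_def compact_K_ball_body convex_K_ball_body)
    have "X = (\<Inter>a\<in>A. (+) a ` K_ball K 0 r)"
      by (simp add: X_def K_ball_body_def flip: K_ball_eq_translate)
    then have "summand X (K_ball K 0 r)"
      using gen[of r] \<rho> False A unfolding generating_set_def by auto
    then obtain C where C: "C \<noteq> {}" "compact C" "convex C" and XC: "X + C = K_ball K 0 r"
      by (auto simp: summand_def)
    have sub: "uminus ` A \<subseteq> C"
    proof
      fix z assume "z \<in> uminus ` A"
      then obtain a where a: "a \<in> A" "z = - a" by blast
      have "x + z \<in> X + C" if "x \<in> X" for x
        unfolding XC K_ball_iff using that a by (simp add: X_def K_ball_body_iff)
      then show "z \<in> C"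
        using set_plus_cancel_translate[OF X(1) False C(3) compact_imp_closed[OF C(2)]] by blast
    qed
    have "vol A = vol (uminus ` A)"
      using measure_lebesgue_affine[of "-1" 0 A] by simp
    also have "\<dots> \<le> vol C"
      by (intro measure_mono_compact sub compact_negations A C)
    finally have vol_le: "vol A \<le> vol C" .
    have "(root ?n (vol X) + root ?n (vol A)) ^ ?n \<le> (root ?n (vol X) + root ?n (vol C)) ^ ?n"
      by (intro power_mono add_mono add_nonneg_nonneg) (use vol_le in auto)
    also have "\<dots> \<le> vol (X + C)"
      using brunn_minkowski_convex[of X C] X C False by (simp add: compact_imp_bounded DIM_cart)
    also have "\<dots> = r ^ ?n * vol K"
      using \<rho> by (simp add: XC vol_K_ball)
    also have "\<dots> = (r * root ?n (vol K)) ^ ?n"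
      by (simp add: power_mult_distrib)
    finally have "root ?n (vol X) + root ?n (vol A) \<le> r * root ?n (vol K)"
      by (rule power_le_imp_le_base[of _ "?n - 1", simplified]) (use \<rho> in auto)
    moreover have "root ?n (vol A) = \<rho> * root ?n (vol K)"
      using \<rho> by (simp add: real_root_mult real_root_power_cancel)
    ultimately have "root ?n (vol X) \<le> (r - \<rho>) * root ?n (vol K)"
      by (simp add: left_diff_distrib)
    then have "root ?n (vol X) ^ ?n \<le> ((r - \<rho>) * root ?n (vol K)) ^ ?n"
      by (rule power_mono) simp
    then have "vol X \<le> (r - \<rho>) ^ ?n * vol K"
      by (simp add: power_mult_distrib)
    then show ?thesis
      using \<rho> by (simp add: vol_K_ball flip: X_def \<rho>_def)
  qed
qed

end

section \<open>Uniform contractions\<close>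

context symmetric_convex_body
begin

text \<open>Extends the defining inequality of volumetric maximizers to all radii. Below the volumetric radius the
  ball body is empty, since a point of it would be the centre of a ball of radius \<open>s\<close> containing \<open>A\<close>; at
  the volumetric radius itself the bound is the limit of the bounds for larger radii.\<close>
lemma vol_K_ball_body_le:
  assumes max: "balls_volumetric_maximizers K"
    and A: "A \<noteq> {}" "compact A" "0 < vol A" and s: "0 \<le> s"
  shows "vol (K_ball_body K s A) \<le> max 0 (s - vol_radius K A) ^ CARD('n) * vol K"
proof (cases "K_ball_body K s A = {}")
  case True
  then show ?thesis using vol_K_pos by simp
next
  case False
  define \<rho> where "\<rho> = vol_radius K A"
  have \<rho>: "0 < \<rho>" "vol A = \<rho> ^ CARD('n) * vol K"
    using vol_radius[OF A(3)] by (auto simp: \<rho>_def)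
  obtain x where x: "x \<in> K_ball_body K s A" using False by blast
  have "A \<subseteq> K_ball K x s"
    using x uminus_scaled by (fastforce simp: K_ball_body_iff K_ball_iff)
  then have "vol A \<le> vol (K_ball K x s)"
    by (intro measure_mono_compact A compact_K_ball)
  then have "\<rho> ^ CARD('n) \<le> s ^ CARD('n)"
    using \<rho> s vol_K_pos by (simp add: vol_K_ball)
  then have "\<rho> \<le> s"
    using \<rho> s by (simp add: power_mono_iff)
  have le: "vol (K_ball_body K s A) \<le> (s + e - \<rho>) ^ CARD('n) * vol K" if "0 < e" for e
  proof -
    have "vol (K_ball_body K s A) \<le> vol (K_ball_body K (s + e) A)"
    proof (rule measure_mono_compact)
      show "K_ball_body K s A \<subseteq> K_ball_body K (s + e) A"
        using s that scaled_mono[of s "s + e"] by (auto simp: K_ball_body_iff)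
    qed (use A compact_K_ball_body in auto)
    also have "\<dots> \<le> vol (K_ball K 0 (s + e - \<rho>))"
      using max A \<open>\<rho> \<le> s\<close> that unfolding balls_volumetric_maximizers_def \<rho>_def by auto
    also have "\<dots> = (s + e - \<rho>) ^ CARD('n) * vol K"
      using \<open>\<rho> \<le> s\<close> that by (simp add: vol_K_ball)
    finally show ?thesis .
  qed
  have "((\<lambda>e. (s + e - \<rho>) ^ CARD('n) * vol K) \<longlongrightarrow> (s + 0 - \<rho>) ^ CARD('n) * vol K) (at_right 0)"
    by (intro tendsto_intros)
  moreover have "\<forall>\<^sub>F e in at_right 0. vol (K_ball_body K s A) \<le> (s + e - \<rho>) ^ CARD('n) * vol K"
    using le by (auto simp: eventually_at_right_field intro: exI[of _ 1])
  ultimately have "vol (K_ball_body K s A) \<le> (s + 0 - \<rho>) ^ CARD('n) * vol K"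
    by (rule tendsto_lowerbound) simp
  then show ?thesis
    using \<open>\<rho> \<le> s\<close> by (simp add: max_def flip: \<rho>_def)
qed

text \<open>A point of the interior can be stretched slightly without leaving the body, and stretching the point
  amounts to shrinking the body.\<close>
lemma interior_scaled_shrink:
  assumes "0 < a" "z \<in> interior ((*\<^sub>R) a ` K)"
  obtains \<mu> where "0 \<le> \<mu>" "\<mu> < a" "z \<in> (*\<^sub>R) \<mu> ` K"
proof -
  have "((\<lambda>t. (1 + t) *\<^sub>R z) \<longlongrightarrow> (1 + 0) *\<^sub>R z) (at_right (0::real))"
    by (intro tendsto_intros)
  then have "\<forall>\<^sub>F t in at_right 0. (1 + t) *\<^sub>R z \<in> interior ((*\<^sub>R) a ` K)"
    using assms by (intro topological_tendstoD) auto
  then obtain b where b: "0 < b" "\<And>t. 0 < t \<Longrightarrow> t < b \<Longrightarrow> (1 + t) *\<^sub>R z \<in> interior ((*\<^sub>R) a ` K)"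
    by (auto simp: eventually_at_right_field)
  define t where "t = b / 2"
  have t: "0 < t" "t < b" using b by (auto simp: t_def)
  then obtain y where y: "y \<in> K" "(1 + t) *\<^sub>R z = a *\<^sub>R y"
    using b(2) interior_subset by blast
  have "z = (1 / (1 + t)) *\<^sub>R ((1 + t) *\<^sub>R z)" using t by simp
  then have "z = (a / (1 + t)) *\<^sub>R y" unfolding y(2) by simp
  then show ?thesis
    using that[of "a / (1 + t)"] t y assms by (auto simp: field_simps)
qed

text \<open>An interior point of the one ball has norm distance less than \<open>a\<close> from \<open>x\<close>, so by the triangle inequality
  it is not in the other one. The common points therefore lie on the boundary of a convex set.\<close>
lemma negligible_Int_K_balls:
  assumes "0 < a" "2 * a \<le> K_norm K (x - y)"
  shows "negligible (K_ball K x a \<inter> K_ball K y a)"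
proof -
  have "z \<notin> interior (K_ball K x a)" if "z \<in> K_ball K y a" for z
  proof
    assume "z \<in> interior (K_ball K x a)"
    then have "z - x \<in> interior ((*\<^sub>R) a ` K)"
      unfolding K_ball_def interior_translation by auto
    then obtain \<mu> where \<mu>: "0 \<le> \<mu>" "\<mu> < a" "z - x \<in> (*\<^sub>R) \<mu> ` K"
      by (rule interior_scaled_shrink[OF assms(1)])
    have "- (z - x) + (z - y) \<in> (*\<^sub>R) (\<mu> + a) ` K"
      using \<mu> that assms by (intro scaled_add uminus_scaled) (auto simp: K_ball_iff)
    then have "K_norm K (x - y) \<le> \<mu> + a"
      using \<mu> by (intro K_norm_least) auto
    then show False using \<mu> assms by simp
  qed
  then have "K_ball K x a \<inter> K_ball K y a \<subseteq> frontier (K_ball K x a)"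
    using closure_subset by (auto simp: frontier_def)
  then show ?thesis
    using negligible_convex_frontier[OF convex_K_ball] negligible_subset by blast
qed

text \<open>Both volumes are compared with that of a ball of radius \<open>r - l\<close>, read as \<open>0\<close> if \<open>r < l\<close>. Packing the balls
  of radius \<open>h = l / 2\<close> about the points \<open>p i\<close> bounds the one from above; the triangle inequality about
  \<open>q 1\<close> bounds the other from below.\<close>
lemma vol_le_if_uniform_contraction:
  fixes p q :: "nat \<Rightarrow> real ^ 'n"
  assumes max: "balls_volumetric_maximizers K" and contr: "uniform_contraction K N l q p"
    and r: "0 < r" and N: "3 ^ CARD('n) \<le> N"
  shows "vol (K_ball_body K r (p ` {1..N})) \<le> vol (K_ball_body K r (q ` {1..N}))"
proof -
  let ?n = "CARD('n)"
  define h where "h = l / 2"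
  have l: "0 < l" and h: "0 < h" "l = 2 * h"
    using contr by (auto simp: uniform_contraction_def h_def)
  have N1: "1 \<le> N" using N by (metis le_trans one_le_numeral one_le_power)
  define A where "A = (\<Union>i\<in>{1..N}. K_ball K (p i) h)"
  have A: "A \<noteq> {}" "compact A"
    unfolding A_def using N1 zero_in_scaled compact_K_ball by (auto simp: K_ball_def)
  have sep: "negligible (K_ball K (p i) h \<inter> K_ball K (p j) h)" if "i \<in> {1..N}" "j \<in> {1..N}" "i \<noteq> j" for i j
  proof -
    have *: "negligible (K_ball K (p i) h \<inter> K_ball K (p j) h)" if "1 \<le> i" "i < j" "j \<le> N" for i j
      by (rule negligible_Int_K_balls) (use contr h that in \<open>auto simp: uniform_contraction_def\<close>)
    show ?thesis
      using *[of i j] *[of j i] that by (cases "i < j") (auto simp: Int_commute)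
  qed
  have "vol A = (\<Sum>i\<in>{1..N}. vol (K_ball K (p i) h))"
    unfolding A_def
    by (rule measure_negligible_finite_Union_image)
      (use sep compact_K_ball in \<open>auto simp: pairwise_def intro: lmeasurable_compact\<close>)
  also have "\<dots> = N * (h ^ ?n * vol K)"
    using h by (simp add: vol_K_ball)
  also have "\<dots> = (root ?n N * h) ^ ?n * vol K"
    by (simp add: power_mult_distrib)
  finally have vol_A: "vol A = (root ?n N * h) ^ ?n * vol K" .
  have root3: "3 \<le> root ?n N"
  proof -
    have "(3::real) ^ ?n \<le> N" using N by (metis of_nat_le_iff of_nat_numeral of_nat_power)
    then have "root ?n (3 ^ ?n) \<le> root ?n N" by (intro real_root_le_mono) auto
    then show ?thesis by (simp add: real_root_power_cancel)
  qed
  then have radius: "vol_radius K A = root ?n N * h"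
    using h N1 vol_A by (intro vol_radius_unique mult_pos_pos) auto
  have "0 < vol A"
    unfolding vol_A by (intro mult_pos_pos zero_less_power vol_K_pos) (use N1 h in auto)
  have "K_ball_body K r (p ` {1..N}) \<subseteq> K_ball_body K (r + h) A"
  proof
    fix x assume x: "x \<in> K_ball_body K r (p ` {1..N})"
    show "x \<in> K_ball_body K (r + h) A"
      unfolding K_ball_body_iff
    proof
      fix a assume "a \<in> A"
      then obtain i where i: "i \<in> {1..N}" "a - p i \<in> (*\<^sub>R) h ` K"
        unfolding A_def UN_iff K_ball_iff by blast
      then have "(x - p i) + - (a - p i) \<in> (*\<^sub>R) (r + h) ` K"
        using x r h by (intro scaled_add uminus_scaled) (auto simp: K_ball_body_iff)
      then show "x - a \<in> (*\<^sub>R) (r + h) ` K" by simp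
    qed
  qed
  then have "vol (K_ball_body K r (p ` {1..N})) \<le> vol (K_ball_body K (r + h) A)"
    by (rule measure_mono_compact) (use A N1 in \<open>auto intro!: compact_K_ball_body\<close>)
  also have "\<dots> \<le> max 0 (r + h - vol_radius K A) ^ ?n * vol K"
    using r h by (intro vol_K_ball_body_le max A \<open>0 < vol A\<close>) auto
  also have "\<dots> \<le> max 0 (r - l) ^ ?n * vol K"
  proof -
    have "3 * h \<le> root ?n N * h" using root3 h by (intro mult_right_mono) auto
    then have "r + h - vol_radius K A \<le> r - l" using h by (simp add: radius)
    then show ?thesis
      using vol_K_pos by (intro mult_right_mono power_mono) auto
  qed
  also have "\<dots> \<le> vol (K_ball_body K r (q ` {1..N}))"
  proof (cases "l \<le> r")
    case False
    then show ?thesis by (simp add: max_def zero_power)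
  next
    case True
    have "K_ball K (q 1) (r - l) \<subseteq> K_ball_body K r (q ` {1..N})"
    proof
      fix x assume x: "x \<in> K_ball K (q 1) (r - l)"
      have "x - q i \<in> (*\<^sub>R) r ` K" if i: "1 \<le> i" "i \<le> N" for i
      proof -
        have "q 1 - q i \<in> (*\<^sub>R) l ` K"
          using contr l i zero_in_scaled
          by (cases "i = 1") (auto simp: uniform_contraction_def K_norm_le_iff)
        then have "(x - q 1) + (q 1 - q i) \<in> (*\<^sub>R) ((r - l) + l) ` K"
          using x True l by (intro scaled_add) (auto simp: K_ball_iff)
        then show ?thesis by simp
      qed
      then show "x \<in> K_ball_body K r (q ` {1..N})"
        by (auto simp: K_ball_body_iff)
    qed
    then have "vol (K_ball K (q 1) (r - l)) \<le> vol (K_ball_body K r (q ` {1..N}))"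
      by (rule measure_mono_compact) (use N1 in \<open>auto intro!: compact_K_ball compact_K_ball_body\<close>)
    then show ?thesis
      using True by (simp add: vol_K_ball max_def)
  qed
  finally show ?thesis .
qed

end

theorem mainTheorem4:
  fixes K :: "(real ^ 'n) set"
  assumes "convex_body K" and "o_symmetric K"
  shows "((\<forall>x r. 0 < r \<longrightarrow> generating_set (K_ball K x r)) \<longrightarrow> balls_volumetric_maximizers K)
    \<and> (balls_volumetric_maximizers K \<longrightarrow>
        (\<forall>(N::nat) (p :: nat \<Rightarrow> real ^ 'n) (q :: nat \<Rightarrow> real ^ 'n) (r::real) (l::real).
           uniform_contraction K N l q p \<and> 0 < r \<and> 0 < l \<and> 1 < CARD('n) \<and> 3 ^ CARD('n) \<le> N \<longrightarrow>
           vol (K_ball_body K r (p ` {1..N})) \<le> vol (K_ball_body K r (q ` {1..N}))))"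
proof -
  interpret symmetric_convex_body K
    using assms by unfold_locales
  show ?thesis
    using volumetric_maximizers_if_generating vol_le_if_uniform_contraction by blast
qed

end
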